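(* If $P_n\to P$ weakly and $\gamma^*_{P_n}$ is an optimal (or $\varepsilon$-optimal) policy for the single-stage problem with prior $P_n$, it does not follow that $J(P,Q,\gamma^*_{P_n})\to J^*(P,Q)$, even if $c$ is bounded and continuous in both $x$ and $u$. That is: there exist Borel sets $\mathbb{X},\mathbb{Y},\mathbb{U}$, a bounded continuous $c:\mathbb{X}\times\mathbb{U}\to\mathbb{R}$, a channel $Q$ from $\mathbb{X}$ to $\mathbb{Y}$, probability measures $P,P_1,P_2,\dots$ on $\mathbb{X}$ with $P_n\to P$ weakly, and policies $\gamma^*_{P_n}\in\Gamma$ with $J(P_n,Q,\gamma^*_{P_n})=J^*(P_n,Q)$ for every $n$ (so in particular $\varepsilon$-optimal for every $\varepsilon>0$), such that $J(P,Q,\gamma^*_{P_n})\not\to J^*(P,Q)$.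
   Context: $\mathbb{X}\subset\mathbb{R}^n$, $\mathbb{Y}\subset\mathbb{R}^m$ and $\mathbb{U}$ (a subset of some Euclidean space) are Borel sets. A channel $Q$ is a stochastic kernel from $\mathbb{X}$ to $\mathbb{Y}$. $\Gamma$ is the set of Borel measurable functions $\gamma:\mathbb{Y}\to\mathbb{U}$. Define $$J(P,Q,\gamma)=\int_{\mathbb{X}}\int_{\mathbb{Y}}c(x,\gamma(y))\,Q(dy|x)\,P(dx),\qquad J^*(P,Q)=\inf_{\gamma\in\Gamma}J(P,Q,\gamma).$$ *)

theory Defs
  imports "HOL-Probability.Probability"
begin

text \<open>
  For a Borel set \<open>X\<close>, the measurable space \<open>X\<close> is \<open>restrict_space borel X\<close>: carrier \<open>X\<close>, measurable
  sets the Borel subsets of \<open>X\<close>.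
\<close>

definition prob_measures_on :: "'a::topological_space set \<Rightarrow> 'a measure set" where
  "prob_measures_on X = space (prob_algebra (restrict_space borel X))"

definition channels ::
  "'a::topological_space set \<Rightarrow> 'b::topological_space set \<Rightarrow> ('a \<Rightarrow> 'b measure) set" where
  "channels X Y = restrict_space borel X \<rightarrow>\<^sub>M prob_algebra (restrict_space borel Y)"

definition policies ::
  "'b::topological_space set \<Rightarrow> 'u::topological_space set \<Rightarrow> ('b \<Rightarrow> 'u) set" where
  "policies Y U = restrict_space borel Y \<rightarrow>\<^sub>M restrict_space borel U"

text \<open>
  The library notion \<open>weak_conv_m\<close> is defined through distribution functions and covers measures on
  the real line only. The test functions below are continuous on the subspace \<open>X\<close>; they need not
  extend continuously to the ambient space.
\<close>

definition weakly_converges_on ::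
  "'a::topological_space set \<Rightarrow> (nat \<Rightarrow> 'a measure) \<Rightarrow> 'a measure \<Rightarrow> bool" where
  "weakly_converges_on X Pn P \<longleftrightarrow>
     (\<forall>f :: 'a \<Rightarrow> real. continuous_on X f \<and> bounded (f ` X) \<longrightarrow>
        (\<lambda>n. \<integral>x. f x \<partial>Pn n) \<longlonglongrightarrow> (\<integral>x. f x \<partial>P))"

definition cost_J ::
  "('a \<times> 'u \<Rightarrow> real) \<Rightarrow> 'a measure \<Rightarrow> ('a \<Rightarrow> 'b measure) \<Rightarrow> ('b \<Rightarrow> 'u) \<Rightarrow> real" where
  "cost_J c P Q \<gamma> = (\<integral>x. (\<integral>y. c (x, \<gamma> y) \<partial>Q x) \<partial>P)"

text \<open>
  A real-valued infimum: it is the intended one when \<open>c\<close> is bounded and measurable on \<open>X \<times> U\<close> and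
  \<open>policies Y U\<close> is nonempty.
\<close>

definition opt_cost ::
  "'b::topological_space set \<Rightarrow> 'u::topological_space set \<Rightarrow> ('a \<times> 'u \<Rightarrow> real) \<Rightarrow>
   'a measure \<Rightarrow> ('a \<Rightarrow> 'b measure) \<Rightarrow> real" where
  "opt_cost Y U c P Q = (INF \<gamma>\<in>policies Y U. cost_J c P Q \<gamma>)"

end

theory Submission
  imports Defs
begin

text \<open>
  An optimal policy is unconstrained off the support of the observation. Let the prior be a point
  mass at \<open>x\<close>, observed through the noiseless channel \<open>y = g x = norm x *\<^sub>R 1\<close>, with cost
  \<open>min 1 (norm u)\<close>. The policy playing \<open>0\<close> at every \<open>y \<noteq> 0\<close> and \<open>1\<close> at \<open>y = 0\<close> is optimal for each
  point mass at \<open>x \<noteq> 0\<close>, but for their weak limit, the point mass at \<open>0\<close>, its cost is positive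
  instead of \<open>0\<close>.
\<close>

lemma restrict_space_borel_UNIV: "restrict_space borel UNIV = borel"
  by (simp add: restrict_space_def measure_of_of_measure flip: space_borel)

lemma return_in_prob_measures_on_UNIV:
  "return borel x \<in> prob_measures_on (UNIV :: 'a::topological_space set)"
  by (simp add: prob_measures_on_def restrict_space_borel_UNIV space_prob_algebra prob_space_return)

lemma deterministic_in_channels_UNIV:
  assumes "g \<in> borel_measurable borel"
  shows "(\<lambda>x. return borel (g x)) \<in> channels UNIV UNIV"
  using assms by (simp add: channels_def restrict_space_borel_UNIV measurable_compose[OF _ measurable_return_prob_space])

text \<open>Integrating against a point mass evaluates the test function, so the claim reduces to
  its sequential continuity at \<open>x\<close>.\<close>

lemma weakly_converges_on_UNIV_return:
  fixes x :: "'a::t2_space"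
  assumes "X \<longlonglongrightarrow> x"
  shows "weakly_converges_on UNIV (\<lambda>n. return borel (X n)) (return borel x)"
  unfolding weakly_converges_on_def
proof (intro allI impI, elim conjE)
  fix f :: "'a \<Rightarrow> real"
  assume f: "continuous_on UNIV f"
  then have "(\<lambda>n. f (X n)) \<longlonglongrightarrow> f x"
    using assms continuous_on_tendsto_compose[OF f] by simp
  with f show "(\<lambda>n. \<integral>x. f x \<partial>return borel (X n)) \<longlonglongrightarrow> (\<integral>x. f x \<partial>return borel x)"
    by (simp add: integral_return borel_measurable_continuous_onI)
qed

theorem proposition3p2:
  shows "\<exists>(X :: (real ^ 'n) set) (Y :: (real ^ 'm) set) (U :: (real ^ 'k) set)
           (c :: (real ^ 'n) \<times> (real ^ 'k) \<Rightarrow> real) Q P Pn \<gamma>.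
           X \<in> sets borel \<and> Y \<in> sets borel \<and> U \<in> sets borel \<and>
           continuous_on (X \<times> U) c \<and> bounded (c ` (X \<times> U)) \<and>
           Q \<in> channels X Y \<and>
           P \<in> prob_measures_on X \<and> (\<forall>n :: nat. Pn n \<in> prob_measures_on X) \<and>
           weakly_converges_on X Pn P \<and>
           (\<forall>n. \<gamma> n \<in> policies Y U) \<and>
           (\<forall>n. cost_J c (Pn n) Q (\<gamma> n) = opt_cost Y U c (Pn n) Q) \<and>
           \<not> (\<lambda>n. cost_J c P Q (\<gamma> n)) \<longlonglongrightarrow> opt_cost Y U c P Q"
proof -
  define c :: "(real ^ 'n) \<times> (real ^ 'k) \<Rightarrow> real" where "c = (\<lambda>(x, u). min 1 (norm u))"
  \<comment> \<open>The dimensions of source and target are unrelated, so \<open>x\<close> is sent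
    through its norm. All that is used later is that \<open>g\<close> is measurable and vanishes
    exactly at \<open>0\<close>.\<close>
  define g :: "real ^ 'n \<Rightarrow> real ^ 'm" where "g x = norm x *\<^sub>R 1" for x
  define Q where "Q x = return borel (g x)" for x
  define \<gamma> :: "real ^ 'm \<Rightarrow> real ^ 'k" where "\<gamma> y = (if y = 0 then 1 else 0)" for y
  \<comment> \<open>\<open>Suc\<close> keeps every term nonzero: \<open>1 / 0 = 0\<close> would put
    the first prior at \<open>0\<close>, where \<open>\<gamma>\<close> is not optimal.\<close>
  define X :: "nat \<Rightarrow> real ^ 'n" where "X n = (1 / real (Suc n)) *\<^sub>R 1" for n
  have g: "g \<in> borel_measurable borel"
    unfolding g_def by measurable
  have \<gamma>: "\<gamma> \<in> policies UNIV UNIV"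
    unfolding policies_def \<gamma>_def by simp
  have X: "X \<longlonglongrightarrow> 0"
    unfolding X_def by (rule tendsto_eq_intros lim_1_over_n[THEN filterlim_compose] filterlim_Suc | simp)+
  \<comment> \<open>Both integrals are against point masses; measurability of
    \<open>\<delta>\<close> lets each be evaluated.\<close>
  have cost: "cost_J c (return borel x) Q \<delta> = min 1 (norm (\<delta> (g x)))"
    if "\<delta> \<in> policies UNIV UNIV" for x \<delta>
  proof -
    have [measurable]: "\<delta> \<in> borel_measurable borel" "g \<in> borel_measurable borel"
      using that g by (simp_all add: policies_def restrict_space_borel_UNIV)
    show ?thesis
      unfolding cost_J_def Q_def c_def by (simp add: integral_return)
  qed
  have zero: "(\<lambda>_. 0) \<in> policies UNIV UNIV"
    by (simp add: policies_def)
  \<comment> \<open>Costs are nonnegative and the constant policy \<open>0\<close> has cost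
    \<open>0\<close>, so the infimum is attained for every \<open>x\<close>, the limit point
    included.\<close>
  have opt: "opt_cost UNIV UNIV c (return borel x) Q = 0" for x
    unfolding opt_cost_def
    by (rule cInf_eq_minimum) (use zero in \<open>auto simp: cost image_iff intro!: bexI[OF _ zero]\<close>)
  have "continuous_on UNIV c"
    unfolding c_def case_prod_unfold by (intro continuous_intros)
  moreover have "bounded (range c)"
    by (rule boundedI[where B = 1]) (auto simp: c_def)
  moreover have "cost_J c (return borel (X n)) Q \<gamma> = 0" for n
    by (simp add: cost \<gamma> g_def X_def \<gamma>_def)
  \<comment> \<open>At \<open>0\<close> the policy plays the nonzero vector \<open>1\<close>, so the
    sequence is constant with value \<open>min 1 (norm 1) > 0\<close>.\<close>
  moreover have "\<not> (\<lambda>_::nat. cost_J c (return borel 0) Q \<gamma>) \<longlonglongrightarrow> 0"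
    by (simp add: cost \<gamma> g_def \<gamma>_def tendsto_const_iff min_def)
  moreover have "Q \<in> channels UNIV UNIV"
    unfolding Q_def by (rule deterministic_in_channels_UNIV[OF g])
  ultimately show ?thesis
    using \<gamma>
    by (intro exI[of _ UNIV] exI[of _ c] exI[of _ Q] exI[of _ "return borel 0"]
          exI[of _ "\<lambda>n. return borel (X n)"] exI[of _ "\<lambda>_. \<gamma>"])
       (simp add: opt return_in_prob_measures_on_UNIV weakly_converges_on_UNIV_return[OF X])
qed

end
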